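(* Let $p(x,y), g(x,y) \in \mathbb{R}[x,y]$ be two polynomials that have the same zero set in $\mathbb{R}^2$, and let $n = \deg[p]$ be the total degree of $p$. If there are infinitely many parallel lines in $\mathbb{R}^2$ (an infinite family of pairwise parallel distinct lines) each of which intersects this zero set in at least $n$ distinct points, then $p$ and $g$ have a common factor in $\mathbb{R}[x,y]$ with the same zero set as $p$ and $g$.
   Context: The zero set of $f\in\mathbb{R}[x,y]$ is $\{(a,b)\in\mathbb{R}^2 : f(a,b)=0\}$. The degree of a term of a two-variable polynomial is the sum of the exponents of the variables in the term, and $\deg[p]$ is the maximum of the degrees of the terms of $p$ (the total degree). A common factor of $p$ and $g$ is a polynomial in $\mathbb{R}[x,y]$ dividing both $p$ and $g$ in $\mathbb{R}[x,y]$. *)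

theory Defs
  imports "HOL-Analysis.Analysis" "HOL-Computational_Algebra.Computational_Algebra"
begin

(* The ring R[x,y] is rendered as R[x][y]: the coefficient of x^i y^j in p is
   coeff (coeff p j) i. *)

definition eval2 :: "real poly poly \<Rightarrow> real \<times> real \<Rightarrow> real" where
  "eval2 p z = poly (poly p [:snd z:]) (fst z)"

lemma eval2_eq_sum:
  "eval2 p (a, b) = (\<Sum>j\<le>degree p. \<Sum>i\<le>degree (coeff p j). coeff (coeff p j) i * a ^ i * b ^ j)"
  by (simp add: eval2_def poly_altdef[of p] poly_sum poly_altdef[of "coeff p _"] sum_distrib_right)

definition zero_set :: "real poly poly \<Rightarrow> (real \<times> real) set" where
  "zero_set p = {z. eval2 p z = 0}"

(* The zero polynomial has no terms; its total degree is 0 by convention. *)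
definition total_degree :: "real poly poly \<Rightarrow> nat" where
  "total_degree p = (if p = 0 then 0 else Max {i + j | i j. coeff (coeff p j) i \<noteq> 0})"

(* Max is only meaningful on finite sets. *)
lemma finite_exponent_sums:
  fixes p :: "real poly poly"
  shows "finite {i + j | i j. coeff (coeff p j) i \<noteq> 0}"
proof -
  have "{i + j | i j. coeff (coeff p j) i \<noteq> 0}
      \<subseteq> (\<lambda>(j, i). i + j) ` (SIGMA j:{..degree p}. {..degree (coeff p j)})"
    by (force dest: le_degree intro!: le_degree simp: image_iff)
  then show ?thesis
    by (rule finite_subset) auto
qed

definition line :: "(real \<times> real) set \<Rightarrow> bool" where
  "line L \<longleftrightarrow> affine L \<and> aff_dim L = 1"

end

theory Submission
  imports Defs
begin

text \<open>
  After a linear change of coordinates the lines are vertical. A nonzero polynomial whose degree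
  in \<open>y\<close> is less than \<open>n\<close> cannot have \<open>n\<close> zeros on each of infinitely many vertical lines, so
  \<open>p\<close> has degree exactly \<open>n\<close> in \<open>y\<close>, and its coefficient of \<open>y ^ n\<close> is a constant because the
  total degree is \<open>n\<close>. Hence \<open>g\<close> can be divided by \<open>p\<close> in \<open>\<real>[x][y]\<close>. The remainder
  vanishes wherever \<open>p\<close> does and has degree less than \<open>n\<close> in \<open>y\<close>, so it is zero. Thus \<open>p\<close>
  itself is the required common factor.
\<close>

section \<open>Evaluation of polynomials, and vanishing on vertical lines\<close>

lemma eval2_add [simp]: "eval2 (p + q) z = eval2 p z + eval2 q z"
  and eval2_diff [simp]: "eval2 (p - q) z = eval2 p z - eval2 q z"
  and eval2_mult [simp]: "eval2 (p * q) z = eval2 p z * eval2 q z"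
  and eval2_power [simp]: "eval2 (p ^ k) z = eval2 p z ^ k"
  and eval2_0 [simp]: "eval2 0 z = 0"
  and eval2_smult [simp]: "eval2 (smult a p) z = poly a (fst z) * eval2 p z"
  by (simp_all add: eval2_def)

lemma eval2_sum [simp]: "eval2 (\<Sum>i\<in>A. f i) z = (\<Sum>i\<in>A. eval2 (f i) z)"
  by (simp add: eval2_def poly_sum)

lemma eval2_fibre: "eval2 p (c, y) = poly (map_poly (\<lambda>a. poly a c) p) y"
  by (induction p) (simp_all add: eval2_def map_poly_pCons)

text \<open>For \<open>c\<close> in \<open>C\<close>, the restriction of \<open>R\<close> to the
  line \<open>x = c\<close> is a polynomial in \<open>y\<close> with more roots than its degree,
  hence zero. So each coefficient of \<open>R\<close>, a polynomial in \<open>x\<close>, vanishes on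
  the infinite set \<open>C\<close>.\<close>

lemma eq_0_if_many_zeros_on_vertical_lines:
  assumes C: "infinite C"
    and zeros: "\<And>c. c \<in> C \<Longrightarrow> \<exists>A. finite A \<and> degree R < card A \<and> (\<forall>y\<in>A. eval2 R (c, y) = 0)"
  shows "R = 0"
proof -
  have fibre_0: "map_poly (\<lambda>a. poly a c) R = 0" (is "?f = 0") if c: "c \<in> C" for c
  proof (rule ccontr)
    assume nz: "?f \<noteq> 0"
    obtain A where A: "finite A" "degree R < card A" "\<forall>y\<in>A. eval2 R (c, y) = 0"
      using zeros[OF c] by blast
    have "card A \<le> card {y. poly ?f y = 0}"
      using A(3) by (intro card_mono poly_roots_finite nz) (auto simp: eval2_fibre)
    also have "\<dots> \<le> degree ?f"
      by (rule card_poly_roots_bound[OF nz])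
    also have "\<dots> \<le> degree R"
      by (rule map_poly_degree_leq)
    finally show False
      using A(2) by simp
  qed
  have "coeff R j = 0" for j
  proof (rule ccontr)
    assume nz: "coeff R j \<noteq> 0"
    have "C \<subseteq> {c. poly (coeff R j) c = 0}"
    proof
      fix c assume "c \<in> C"
      from fibre_0[OF this] have "coeff (map_poly (\<lambda>a. poly a c) R) j = 0"
        by simp
      then show "c \<in> {c. poly (coeff R j) c = 0}"
        by (simp add: coeff_map_poly)
    qed
    then show False
      using C poly_roots_finite[OF nz] finite_subset by blast
  qed
  then show ?thesis
    by (simp add: poly_eq_iff)
qed

text \<open>Allows identities in the polynomial ring to be checked pointwise, so that changes of
  coordinates can be handled on values.\<close>

lemma eval2_eqI:
  assumes "\<And>z. eval2 p z = eval2 q z"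
  shows "p = q"
proof -
  have "p - q = 0"
  proof (rule eq_0_if_many_zeros_on_vertical_lines)
    show "infinite (UNIV :: real set)"
      by (rule infinite_UNIV_char_0)
  next
    fix c :: real
    \<comment> \<open>As \<open>p - q\<close> vanishes everywhere, any
      \<open>degree (p - q) + 1\<close> reals will do; the naturals up to the degree are
      taken.\<close>
    have "degree (p - q) < card (real ` {..degree (p - q)})"
      by (simp add: card_image)
    then show "\<exists>A. finite A \<and> degree (p - q) < card A \<and> (\<forall>y\<in>A. eval2 (p - q) (c, y) = 0)"
      using assms by (intro exI[of _ "real ` {..degree (p - q)}"]) simp
  qed
  then show ?thesis
    by simp
qed

section \<open>Bounds on the total degree, and linear substitutions\<close>

definition total_degree_le :: "nat \<Rightarrow> real poly poly \<Rightarrow> bool" where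
  "total_degree_le n p \<longleftrightarrow> (\<forall>i j. coeff (coeff p j) i \<noteq> 0 \<longrightarrow> i + j \<le> n)"

text \<open>From here on only upper bounds on the degree matter. They hold for \<open>0\<close> and
  pass to sums and products, with no maximum to compute.\<close>

lemma total_degree_le_total_degree: "total_degree_le (total_degree p) p"
proof -
  have "i + j \<le> total_degree p" if "coeff (coeff p j) i \<noteq> 0" for i j
  proof -
    have "p \<noteq> 0"
      using that by auto
    moreover have "i + j \<le> Max {i + j | i j. coeff (coeff p j) i \<noteq> 0}"
      using that by (intro Max_ge finite_exponent_sums) auto
    ultimately show ?thesis
      by (simp add: total_degree_def)
  qed
  then show ?thesis
    by (simp add: total_degree_le_def)
qed

lemma total_degree_le_0 [simp]: "total_degree_le n 0"
  by (simp add: total_degree_le_def)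

lemma total_degree_le_sum:
  assumes "\<And>i. i \<in> A \<Longrightarrow> total_degree_le n (f i)"
  shows "total_degree_le n (\<Sum>i\<in>A. f i)"
  using assms unfolding total_degree_le_def
  by (simp add: coeff_sum) (meson sum.neutral)

lemma total_degree_le_mono: "total_degree_le m p \<Longrightarrow> m \<le> n \<Longrightarrow> total_degree_le n p"
  unfolding total_degree_le_def using order_trans by blast

lemma total_degree_le_mult:
  assumes p: "total_degree_le m p" and q: "total_degree_le n q"
  shows "total_degree_le (m + n) (p * q)"
proof -
  have "i + j \<le> m + n" if nz: "coeff (coeff (p * q) j) i \<noteq> 0" for i j
  proof -
    have "(\<Sum>k\<le>j. \<Sum>l\<le>i. coeff (coeff p k) l * coeff (coeff q (j - k)) (i - l)) \<noteq> 0"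
      using nz by (simp add: coeff_mult coeff_sum)
    then obtain k where k: "k \<le> j"
      and "(\<Sum>l\<le>i. coeff (coeff p k) l * coeff (coeff q (j - k)) (i - l)) \<noteq> 0"
      by (metis (no_types, lifting) atMost_iff sum.neutral)
    then obtain l where l: "l \<le> i" and "coeff (coeff p k) l * coeff (coeff q (j - k)) (i - l) \<noteq> 0"
      by (metis (no_types, lifting) atMost_iff sum.neutral)
    then have "coeff (coeff p k) l \<noteq> 0" "coeff (coeff q (j - k)) (i - l) \<noteq> 0"
      by simp_all
    then have "l + k \<le> m" "(i - l) + (j - k) \<le> n"
      using p q unfolding total_degree_le_def by blast+
    then show ?thesis
      using k l by linarith
  qed
  then show ?thesis
    by (simp add: total_degree_le_def)
qed

lemma total_degree_le_const: "total_degree_le 0 [:[:a:]:]"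
  by (auto simp: total_degree_le_def coeff_pCons split: nat.splits)

lemma total_degree_le_linear: "total_degree_le 1 [:[:0, a:], [:b:]:]"
  by (auto simp: total_degree_le_def coeff_pCons split: nat.splits)

lemma total_degree_le_power:
  assumes "total_degree_le 1 p"
  shows "total_degree_le k (p ^ k)"
proof (induction k)
  case 0
  show ?case
    using total_degree_le_const[of 1] by (simp add: one_pCons)
next
  case (Suc k)
  then show ?case
    using total_degree_le_mult[OF assms] by simp
qed

text \<open>A monomial of degree \<open>i + j\<close> becomes a product of \<open>i + j\<close>
  linear forms, so the bound \<open>n\<close> survives the substitution.\<close>

lemma linear_substitution_exists:
  assumes p: "total_degree_le n p"
  obtains q where "total_degree_le n q"
    and "\<And>x y. eval2 q (x, y) = eval2 p (a * x + b * y, c * x + d * y)"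
proof
  let ?X = "[:[:0, a:], [:b:]:]" and ?Y = "[:[:0, c:], [:d:]:]"
  let ?q = "\<Sum>j\<le>degree p. \<Sum>i\<le>degree (coeff p j). [:[:coeff (coeff p j) i:]:] * (?X ^ i * ?Y ^ j)"
  have "total_degree_le n ([:[:coeff (coeff p j) i:]:] * (?X ^ i * ?Y ^ j))" for i j
  proof (cases "coeff (coeff p j) i = 0")
    case False
    then have "i + j \<le> n"
      using p by (simp add: total_degree_le_def)
    moreover have "total_degree_le (0 + (i + j)) ([:[:coeff (coeff p j) i:]:] * (?X ^ i * ?Y ^ j))"
      by (intro total_degree_le_mult total_degree_le_const total_degree_le_power
          total_degree_le_linear)
    ultimately show ?thesis
      using total_degree_le_mono by simp
  qed simp
  then show "total_degree_le n ?q"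
    by (intro total_degree_le_sum)
  have lin: "eval2 [:[:0, a:], [:b:]:] (x, y) = a * x + b * y" for a b x y
    by (simp add: eval2_def algebra_simps)
  have const: "eval2 [:[:a:]:] z = a" for a z
    by (simp add: eval2_def)
  show "eval2 ?q (x, y) = eval2 p (a * x + b * y, c * x + d * y)" for x y
    unfolding eval2_eq_sum[of p] eval2_sum eval2_mult eval2_power lin const
    by (simp add: mult.assoc)
qed

section \<open>Division when the lines are vertical\<close>

lemma dvd_if_many_zeros_on_vertical_lines:
  assumes P: "P \<noteq> 0" "total_degree_le n P"
    and C: "infinite C"
    and zeros: "\<And>c. c \<in> C \<Longrightarrow> \<exists>A. finite A \<and> card A = n \<and> (\<forall>y\<in>A. eval2 P (c, y) = 0)"
    and sub: "\<And>z. eval2 P z = 0 \<Longrightarrow> eval2 G z = 0"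
  shows "P dvd G"
proof -
  have coeff_0: "coeff (coeff P j) i = 0" if "n < i + j" for i j
    using P(2) that unfolding total_degree_le_def by (meson not_le)
  then have "degree P \<le> n"
    by (intro degree_le) (simp add: poly_eq_iff)
  moreover have "\<not> degree P < n"
    using eq_0_if_many_zeros_on_vertical_lines[OF C, of P] zeros P(1) by metis
  ultimately have deg: "degree P = n"
    by simp
  \<comment> \<open>A positive power of \<open>x\<close> next to \<open>y ^ n\<close> would exceed
    the total degree \<open>n\<close>.\<close>
  have "degree (coeff P n) = 0"
    using coeff_0 degree_le[of 0 "coeff P n"] by simp
  then obtain l where l: "coeff P n = [:l:]"
    by (rule degree_eq_zeroE)
  have l0: "l \<noteq> 0"
    using P(1) l deg by (metis leading_coeff_0_iff pCons_0_0)
  \<comment> \<open>Pseudo-division works over the coefficient ring of polynomials in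
    \<open>x\<close>; it multiplies \<open>G\<close> by a power of the leading coefficient, here the
    constant \<open>l\<close>.\<close>
  obtain Q R where QR: "pseudo_divmod G P = (Q, R)"
    by (cases "pseudo_divmod G P")
  define k where "k = Suc (degree G) - degree P"
  have eq: "smult ([:l:] ^ k) G = P * Q + R" and R: "R = 0 \<or> degree R < n"
    using pseudo_divmod[OF P(1) QR] by (simp_all add: deg l k_def)
  have "R = 0"
  proof (rule ccontr)
    assume nz: "R \<noteq> 0"
    have R_zero: "eval2 R z = 0" if "eval2 P z = 0" for z
      using arg_cong[OF eq, of "\<lambda>q. eval2 q z"] that sub[OF that] by simp
    have "R = 0"
      using R nz zeros R_zero by (intro eq_0_if_many_zeros_on_vertical_lines[OF C]) metis
    with nz show False ..
  qed
  then have "P dvd smult ([:l:] ^ k) G"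
    using eq by simp
  \<comment> \<open>The extra factor is a unit and can be cancelled.\<close>
  moreover have "[:l:] ^ k dvd 1"
    using l0 by (simp add: is_unit_power_iff is_unit_const_poly_iff dvd_field_iff)
  then obtain m where "1 = [:l:] ^ k * m" ..
  then have "G = smult m (smult ([:l:] ^ k) G)"
    by (simp add: mult.commute)
  ultimately show ?thesis
    by (metis dvd_smult)
qed

section \<open>Reduction from parallel lines to vertical lines\<close>

lemma parallel_lines_direction:
  assumes "\<forall>L\<in>\<L>. line L" and "pairwise affine_parallel \<L>"
  obtains d where "d \<noteq> 0" "\<And>L. L \<in> \<L> \<Longrightarrow> \<exists>a. L = range (\<lambda>t. a + t *\<^sub>R d)"
proof (cases "\<L> = {}")
  case True
  then show ?thesis
    using that[of "(1, 0)"] by (simp add: zero_prod_def)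
next
  case False
  then obtain L0 where L0: "L0 \<in> \<L>"
    by blast
  then have "affine L0" "aff_dim L0 = 1"
    using assms(1) by (auto simp: line_def)
  \<comment> \<open>An affine basis of a line has two points; their difference is the
    direction.\<close>
  moreover obtain B where B: "affine hull B = affine hull L0" "of_nat (card B) = aff_dim L0 + 1"
    using aff_dim_basis_exists[of L0] by blast
  ultimately have "card B = 2"
    by simp
  then obtain a0 b0 where "B = {a0, b0}" "a0 \<noteq> b0"
    by (auto simp: card_2_iff)
  with B(1) \<open>affine L0\<close> have "b0 - a0 \<noteq> 0" "L0 = range (\<lambda>t. a0 + t *\<^sub>R (b0 - a0))"
    by (simp_all add: affine_hull_2_alt hull_same)
  then obtain d where "d \<noteq> 0" and L0_eq: "L0 = range (\<lambda>t. a0 + t *\<^sub>R d)"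
    by blast
  moreover have "\<exists>a. L = range (\<lambda>t. a + t *\<^sub>R d)" if L: "L \<in> \<L>" for L
  proof (cases "L = L0")
    \<comment> \<open>\<open>pairwise\<close> relates distinct members only; each of them is a
      translate of \<open>L0\<close>.\<close>
    case False
    then obtain b where "L = (\<lambda>x. b + x) ` L0"
      using assms(2) L L0 unfolding pairwise_def affine_parallel_def by metis
    then have "L = range (\<lambda>t. (b + a0) + t *\<^sub>R d)"
      by (simp add: L0_eq image_image add.assoc)
    then show ?thesis ..
  qed (use L0_eq in blast)
  ultimately show ?thesis
    using that by blast
qed

theorem corollary9:
  fixes p g :: "real poly poly" and n :: nat and \<L> :: "(real \<times> real) set set"
  assumes same_zeros: "zero_set p = zero_set g"
    and n_def: "n = total_degree p"
    and inf: "infinite \<L>"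
    and lines: "\<forall>L\<in>\<L>. line L"
    and parallel: "pairwise affine_parallel \<L>"
    and meets: "\<forall>L\<in>\<L>. \<exists>A. A \<subseteq> L \<inter> zero_set p \<and> finite A \<and> card A = n"
  shows "\<exists>h. h dvd p \<and> h dvd g \<and> zero_set h = zero_set p \<and> zero_set h = zero_set g"
proof -
  have zeros_iff: "eval2 p z = 0 \<longleftrightarrow> eval2 g z = 0" for z
    using same_zeros by (auto simp: zero_set_def)
  have "p dvd g"
  proof (cases "p = 0")
    case True
    then have "g = 0"
      using zeros_iff by (intro eval2_eqI) simp
    then show ?thesis
      by simp
  next
    case p0: False
    obtain d where d: "d \<noteq> 0" and dir: "\<And>L. L \<in> \<L> \<Longrightarrow> \<exists>a. L = range (\<lambda>t. a + t *\<^sub>R d)"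
      using parallel_lines_direction[OF lines parallel] by metis
    obtain u v where uv: "d = (u, v)"
      by (cases d)
    define r where "r = u\<^sup>2 + v\<^sup>2"
    have r: "r \<noteq> 0"
      using d uv by (auto simp: r_def sum_power2_eq_zero_iff zero_prod_def)
    have total_p: "total_degree_le n p"
      using total_degree_le_total_degree n_def by simp
    \<comment> \<open>\<open>M\<close> maps the vertical line \<open>x = c\<close> onto the line
      through \<open>c * (-v, u)\<close> with direction \<open>d = (u, v)\<close>. Its matrix
      squares to \<open>r\<close> times the identity, so \<open>N\<close>, which is \<open>M\<close>
      divided by \<open>r\<close>, is the inverse.\<close>
    define M where "M x y = (- v * x + u * y, u * x + v * y)" for x y
    define N where "N x y = ((- v / r) * x + (u / r) * y, (u / r) * x + (v / r) * y)" for x y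
    have "M (fst (N x y)) (snd (N x y)) = (x, y)" for x y
    proof -
      have "M (fst (N x y)) (snd (N x y)) = ((u\<^sup>2 + v\<^sup>2) / r * x, (u\<^sup>2 + v\<^sup>2) / r * y)"
        by (simp add: M_def N_def power2_eq_square add_divide_distrib algebra_simps)
      then show ?thesis
        using r by (simp flip: r_def)
    qed
    then have MN: "M a b = (x, y)" if "N x y = (a, b)" for a b x y
      using that by (metis fst_conv snd_conv)
    obtain P where P: "total_degree_le n P" "\<And>x y. eval2 P (x, y) = eval2 p (M x y)"
      using linear_substitution_exists[OF total_p] unfolding M_def by metis
    obtain G where G: "\<And>x y. eval2 G (x, y) = eval2 g (M x y)"
      using linear_substitution_exists[OF total_degree_le_total_degree] unfolding M_def by metis
    define C where "C = {c. \<exists>A. finite A \<and> card A = n \<and> (\<forall>y\<in>A. eval2 P (c, y) = 0)}"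
    have "P dvd G"
    proof (rule dvd_if_many_zeros_on_vertical_lines[OF _ P(1)])
      show "P \<noteq> 0"
      proof
        assume P0: "P = 0"
        have "eval2 p z = 0" for z
          using MN[of "fst z" "snd z"] P(2) P0 by (metis eval2_0 surj_pair prod.collapse)
        then show False
          using p0 eval2_eqI[of p 0] by simp
      qed
    next
      \<comment> \<open>Each given line is the image of a vertical line \<open>x = c\<close> with
        \<open>c\<close> in \<open>C\<close>, so a finite \<open>C\<close> would leave only finitely
        many lines.\<close>
      have "\<L> \<subseteq> (\<lambda>c. range (M c)) ` C"
      proof
        fix L assume L: "L \<in> \<L>"
        obtain a where a: "L = range (\<lambda>t. a + t *\<^sub>R d)"
          using dir[OF L] by blast
        \<comment> \<open>\<open>(c, s)\<close> are the new coordinates of the base point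
          \<open>a\<close>; moving along \<open>d\<close> changes only the second one.\<close>
        obtain c s where cs: "N (fst a) (snd a) = (c, s)"
          by (cases "N (fst a) (snd a)")
        have "a + t *\<^sub>R d = M c (s + t)" for t
          using MN[OF cs] by (cases a) (simp add: M_def uv algebra_simps)
        then have "L = range (\<lambda>t. M c (s + t))"
          using a by simp
        also have "\<dots> = M c ` range ((+) s)"
          by (rule image_image [symmetric])
        finally have L_eq: "L = range (M c)"
          by (simp only: surj_plus)
        have inj: "inj (M c)"
          using d by (auto simp: inj_def M_def uv zero_prod_def)
        obtain A where A: "A \<subseteq> L \<inter> zero_set p" "finite A" "card A = n"
          using bspec[OF meets L] by auto
        \<comment> \<open>Since \<open>M c\<close> is injective and \<open>A\<close> lies in its
          range, pulling \<open>A\<close> back keeps all \<open>n\<close> points.\<close>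
        have "finite (M c -` A)"
          using A(2) inj by (simp add: finite_vimageI)
        moreover have "card (M c -` A) = n"
          using card_vimage_inj[OF inj, of A] A(1,3) L_eq by simp
        moreover have "\<forall>y\<in>M c -` A. eval2 P (c, y) = 0"
          using A(1) P(2) by (auto simp: zero_set_def)
        ultimately have "c \<in> C"
          unfolding C_def by blast
        with L_eq show "L \<in> (\<lambda>c. range (M c)) ` C"
          by blast
      qed
      then show "infinite C"
        using inf finite_subset by blast
    next
      fix z assume "eval2 P z = 0"
      then show "eval2 G z = 0"
        using P(2) G zeros_iff by (cases z) simp
    qed (simp add: C_def)
    then obtain Q where Q: "G = P * Q" ..
    \<comment> \<open>The quotient is carried back to the original coordinates through
      \<open>N\<close>.\<close>
    obtain q where q: "\<And>x y. eval2 q (x, y) = eval2 Q (N x y)"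
      using linear_substitution_exists[OF total_degree_le_total_degree] unfolding N_def by metis
    have "g = p * q"
    proof (rule eval2_eqI)
      fix z :: "real \<times> real"
      obtain x y where z: "z = (x, y)"
        by (cases z)
      obtain a b where ab: "N x y = (a, b)"
        by (cases "N x y")
      have "eval2 g z = eval2 G (a, b)"
        using G MN[OF ab] z by simp
      also have "\<dots> = eval2 P (a, b) * eval2 Q (a, b)"
        by (simp add: Q)
      also have "\<dots> = eval2 (p * q) z"
        using P(2) MN[OF ab] z q ab by simp
      finally show "eval2 g z = eval2 (p * q) z" .
    qed
    then show ?thesis ..
  qed
  then show ?thesis
    using same_zeros by (intro exI[of _ p]) simp
qed

end
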